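(* (Left-unital case.) Let $(A,\alpha,1_l)$ be a left-unital hom-associative algebra. Then, for all $x,y,z\in A$, $$[x,y,\alpha(z)]_{\mathrm{as}}=\alpha([x,y,z]_{\mathrm{as}}).$$ Moreover, if $\alpha$ is injective, then, for all $x,y,z\in A$, $[x,y,\alpha(z)]_{\mathrm{as}}=0\Leftrightarrow [x,y,z]_{\mathrm{as}}=0$, that is, $\alpha(z)\in N^r(A)\Leftrightarrow z\in N^r(A)$. (Right-unital case.) Let $(A,\alpha,1_r)$ be a right-unital hom-associative algebra. Then, for all $x,y,z\in A$, $$[\alpha(x),y,z]_{\mathrm{as}}=\alpha([x,y,z]_{\mathrm{as}}).$$ Moreover, if $\alpha$ is injective, then, for all $x,y,z\in A$, $[\alpha(x),y,z]_{\mathrm{as}}=0\Leftrightarrow [x,y,z]_{\mathrm{as}}=0$, that is, $\alpha(x)\in N^l(A)\Leftrightarrow x\in N^l(A)$.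
   Context: An algebra $A$ over a field $\mathbb{F}$ is a linear space with a bilinear product $(x,y)\mapsto x\cdot y$ (not assumed associative, commutative or unital). A hom-associative algebra $(A,\alpha)$ is an algebra $A$ with a linear map $\alpha\colon A\to A$ such that $\alpha(x)\cdot(y\cdot z)=(x\cdot y)\cdot\alpha(z)$ for all $x,y,z\in A$. It is left-unital (right-unital) if it is equipped with an element $1_l$ ($1_r$) such that $1_l\cdot x=x$ (respectively $x\cdot 1_r=x$) for all $x\in A$. The associator is $[x,y,z]_{\mathrm{as}}=(x\cdot y)\cdot z-x\cdot(y\cdot z)$. The left and right nuclei are $N^l(A)=\{a\in A\mid [a,s,t]_{\mathrm{as}}=0\ \forall s,t\in A\}$ and $N^r(A)=\{a\in A\mid [s,t,a]_{\mathrm{as}}=0\ \forall s,t\in A\}$. *)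

theory Defs
  imports Complex_Main
begin

text \<open>
  The underlying linear space of an algebra is a whole type \<open>'a\<close>, with scalar multiplication
  \<open>scale\<close> over a field \<open>'f\<close>.  The product is a parameter and not the type class operation,
  since it need not be associative, commutative or unital.
\<close>

locale nonassociative_algebra = vector_space scale
  for scale :: "'f::field \<Rightarrow> 'a::ab_group_add \<Rightarrow> 'a" +
  fixes mult :: "'a \<Rightarrow> 'a \<Rightarrow> 'a"
  assumes linear_mult_right: "Vector_Spaces.linear scale scale (\<lambda>y. mult x y)"
    and linear_mult_left: "Vector_Spaces.linear scale scale (\<lambda>x. mult x y)"

locale hom_associative_algebra = nonassociative_algebra scale mult
  for scale :: "'f::field \<Rightarrow> 'a::ab_group_add \<Rightarrow> 'a" and mult :: "'a \<Rightarrow> 'a \<Rightarrow> 'a" +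
  fixes \<alpha> :: "'a \<Rightarrow> 'a"
  assumes linear_twist: "Vector_Spaces.linear scale scale \<alpha>"
    and hom_assoc: "mult (\<alpha> x) (mult y z) = mult (mult x y) (\<alpha> z)"

locale left_unital_hom_associative_algebra = hom_associative_algebra scale mult \<alpha>
  for scale :: "'f::field \<Rightarrow> 'a::ab_group_add \<Rightarrow> 'a" and mult :: "'a \<Rightarrow> 'a \<Rightarrow> 'a"
    and \<alpha> :: "'a \<Rightarrow> 'a" +
  fixes one_l :: 'a
  assumes left_unit: "mult one_l x = x"

locale right_unital_hom_associative_algebra = hom_associative_algebra scale mult \<alpha>
  for scale :: "'f::field \<Rightarrow> 'a::ab_group_add \<Rightarrow> 'a" and mult :: "'a \<Rightarrow> 'a \<Rightarrow> 'a"
    and \<alpha> :: "'a \<Rightarrow> 'a" +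
  fixes one_r :: 'a
  assumes right_unit: "mult x one_r = x"

definition associator :: "('a::ab_group_add \<Rightarrow> 'a \<Rightarrow> 'a) \<Rightarrow> 'a \<Rightarrow> 'a \<Rightarrow> 'a \<Rightarrow> 'a" where
  "associator mult x y z = mult (mult x y) z - mult x (mult y z)"

definition left_nucleus :: "('a::ab_group_add \<Rightarrow> 'a \<Rightarrow> 'a) \<Rightarrow> 'a set" where
  "left_nucleus mult = {a. \<forall>s t. associator mult a s t = 0}"

definition right_nucleus :: "('a::ab_group_add \<Rightarrow> 'a \<Rightarrow> 'a) \<Rightarrow> 'a set" where
  "right_nucleus mult = {a. \<forall>s t. associator mult s t a = 0}"

end

theory Submission
  imports Defs
begin

text \<open>
  A one-sided unit forces the twist to be a multiplication operator: left multiplication by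
  \<open>\<alpha> 1\<^sub>l\<close> in the left-unital case, right multiplication by \<open>\<alpha> 1\<^sub>r\<close> in the right-unital one.
  Substituting this back into hom-associativity lets the twist be pulled out of a product,
  \<open>x \<cdot> \<alpha> y = \<alpha> (x \<cdot> y)\<close> and \<open>\<alpha> x \<cdot> y = \<alpha> (x \<cdot> y)\<close> respectively.  In both terms
  of the associator the twisted element is the outermost factor on the same side of every product
  that contains it, so the twist comes out of each term, and by linearity out of their difference.  An injective linear twist reflects zero, which gives
  the statements on vanishing associators and on the nuclei.
\<close>

context hom_associative_algebra
begin

lemma twist_diff: "\<alpha> (x - y) = \<alpha> x - \<alpha> y"
  using linear_twist by (simp add: linear_iff_module_hom module_hom.diff)

lemma twist_eq_0_iff: "inj \<alpha> \<Longrightarrow> \<alpha> x = 0 \<longleftrightarrow> x = 0"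
  using twist_diff[of 0 0] by (metis diff_self injD)

end

context left_unital_hom_associative_algebra
begin

text \<open>Hom-associativity for the triple \<open>1\<^sub>l, 1\<^sub>l, x\<close>, with all unit factors removed.\<close>

lemma twist_eq_mult_left: "\<alpha> x = mult (\<alpha> one_l) x"
  using hom_assoc[of one_l one_l x] by (simp add: left_unit)

text \<open>
  By the previous lemma the right-hand side is \<open>\<alpha> 1\<^sub>l \<cdot> (x \<cdot> y)\<close>, which hom-associativity
  rebrackets as \<open>(1\<^sub>l \<cdot> x) \<cdot> \<alpha> y\<close>.
\<close>

lemma mult_twist_right: "mult x (\<alpha> y) = \<alpha> (mult x y)"
  using hom_assoc[of one_l x y] by (simp add: left_unit twist_eq_mult_left[of "mult x y"])

lemma associator_twist_right: "associator mult x y (\<alpha> z) = \<alpha> (associator mult x y z)"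
  by (simp add: associator_def mult_twist_right twist_diff)

end

context right_unital_hom_associative_algebra
begin

text \<open>
  The mirror images of the left-unital identities: here the triple is \<open>x, 1\<^sub>r, 1\<^sub>r\<close>, and then
  \<open>x, y, 1\<^sub>r\<close>.
\<close>

lemma twist_eq_mult_right: "\<alpha> x = mult x (\<alpha> one_r)"
  using hom_assoc[of x one_r one_r] by (simp add: right_unit)

lemma mult_twist_left: "mult (\<alpha> x) y = \<alpha> (mult x y)"
  using hom_assoc[of x y one_r] by (simp add: right_unit twist_eq_mult_right[of "mult x y"])

lemma associator_twist_left: "associator mult (\<alpha> x) y z = \<alpha> (associator mult x y z)"
  by (simp add: associator_def mult_twist_left twist_diff)

end

theorem proposition15:
  fixes scale :: "'f::field \<Rightarrow> 'a::ab_group_add \<Rightarrow> 'a"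
    and mult :: "'a \<Rightarrow> 'a \<Rightarrow> 'a"
    and \<alpha> :: "'a \<Rightarrow> 'a"
    and one_l one_r :: 'a
  shows "(left_unital_hom_associative_algebra scale mult \<alpha> one_l \<longrightarrow>
      (\<forall>x y z. associator mult x y (\<alpha> z) = \<alpha> (associator mult x y z)) \<and>
      (inj \<alpha> \<longrightarrow>
        (\<forall>x y z. associator mult x y (\<alpha> z) = 0 \<longleftrightarrow> associator mult x y z = 0) \<and>
        (\<forall>z. \<alpha> z \<in> right_nucleus mult \<longleftrightarrow> z \<in> right_nucleus mult))) \<and>
    (right_unital_hom_associative_algebra scale mult \<alpha> one_r \<longrightarrow>
      (\<forall>x y z. associator mult (\<alpha> x) y z = \<alpha> (associator mult x y z)) \<and>
      (inj \<alpha> \<longrightarrow>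
        (\<forall>x y z. associator mult (\<alpha> x) y z = 0 \<longleftrightarrow> associator mult x y z = 0) \<and>
        (\<forall>x. \<alpha> x \<in> left_nucleus mult \<longleftrightarrow> x \<in> left_nucleus mult)))"
proof (intro conjI impI)
  assume "left_unital_hom_associative_algebra scale mult \<alpha> one_l"
  then interpret left_unital_hom_associative_algebra scale mult \<alpha> one_l .
  show "\<forall>x y z. associator mult x y (\<alpha> z) = \<alpha> (associator mult x y z)"
    by (simp add: associator_twist_right)
  assume "inj \<alpha>"
  then show zero: "\<forall>x y z. associator mult x y (\<alpha> z) = 0 \<longleftrightarrow> associator mult x y z = 0"
    by (simp add: associator_twist_right twist_eq_0_iff)
  show "\<forall>z. \<alpha> z \<in> right_nucleus mult \<longleftrightarrow> z \<in> right_nucleus mult"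
    by (simp add: right_nucleus_def zero)
next
  assume "right_unital_hom_associative_algebra scale mult \<alpha> one_r"
  then interpret right_unital_hom_associative_algebra scale mult \<alpha> one_r .
  show "\<forall>x y z. associator mult (\<alpha> x) y z = \<alpha> (associator mult x y z)"
    by (simp add: associator_twist_left)
  assume "inj \<alpha>"
  then show zero: "\<forall>x y z. associator mult (\<alpha> x) y z = 0 \<longleftrightarrow> associator mult x y z = 0"
    by (simp add: associator_twist_left twist_eq_0_iff)
  show "\<forall>x. \<alpha> x \<in> left_nucleus mult \<longleftrightarrow> x \<in> left_nucleus mult"
    by (simp add: left_nucleus_def zero)
qed

end
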